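(* Let $(U_A,\tau)$ and $(U_B,\delta)$ be soft topological spaces and $f:U_A\to U_B$ a soft function. Then $f$ is soft semicontinuous if and only if $f^{-1}((H_B)^0)\subseteq\mathrm{ssint}(f^{-1}(H_B))$ for every soft set $H_B$ of $U_B$.
   Context: Soft sets. For a universe $U$ and a parameter set $A$, a soft set $F_A$ over $U$ is a map $F:A\to\mathcal P(U)$; $SS(U)_A$ is the set of all of them. $\Phi_A$ has all values $\emptyset$; $U_A$ has all values $U$. Soft inclusion, union, intersection and complement ($(F_A)^c$) are taken parameterwise. "A soft set of $U_A$" means a member of $SS(U)_A$; likewise for $U_B$ with parameter set $B$. Soft topology. A soft topology is a family $\tau\subseteq SS(U)_A$ containing $\Phi_A,U_A$, closed under arbitrary soft unions and under soft intersections of two members; $(U_A,\tau)$ is then a soft topological space. Members of $\tau$ are the open soft sets, their complements the closed soft sets. $\overline{F_A}$ is the intersection of all closed soft sets containing $F_A$, and $(F_A)^0$ is the union of all open soft sets contained in $F_A$. A soft set $G_A$ is semiopen if there is an open soft set $H_A$ with $H_A\subseteq G_A\subseteq\overline{H_A}$. $\mathrm{ssint}\,G_A$ is the union of all semiopen soft sets contained in $G_A$. A soft function $f:U_A\to U_B$ is given by maps $u:U\to U$ and $p:A\to B$; for $F_A\in SS(U)_A$ the image is $f(F_A)(b)=\bigcup_{a\in p^{-1}(b)}u(F(a))$ for $b\in B$, and for $G_B\in SS(U)_B$ the inverse image is $f^{-1}(G_B)(a)=u^{-1}(G(p(a)))$ for $a\in A$. It is soft semicontinuous if $f^{-1}(G_B)$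 is semiopen in $U_A$ for each open soft set $G_B$ of $U_B$. *)

theory Defs
  imports "HOL-Library.FuncSet"
begin

text \<open>
  A soft set over the universe \<open>U\<close> with parameter set \<open>A\<close> is a map from \<open>A\<close> to the power set
  of \<open>U\<close>. Such maps are taken to be extensional (undefined outside \<open>A\<close>), so that two soft sets
  are equal iff they agree on \<open>A\<close>. Both \<open>U\<close> and \<open>A\<close> may be empty.
\<close>

definition soft_sets :: "'u set \<Rightarrow> 'a set \<Rightarrow> ('a \<Rightarrow> 'u set) set" where
  "soft_sets U A = A \<rightarrow>\<^sub>E Pow U"

definition soft_empty :: "'a set \<Rightarrow> 'a \<Rightarrow> 'u set" where
  "soft_empty A = (\<lambda>a\<in>A. {})"

definition soft_whole :: "'u set \<Rightarrow> 'a set \<Rightarrow> 'a \<Rightarrow> 'u set" where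
  "soft_whole U A = (\<lambda>a\<in>A. U)"

definition soft_subset :: "'a set \<Rightarrow> ('a \<Rightarrow> 'u set) \<Rightarrow> ('a \<Rightarrow> 'u set) \<Rightarrow> bool" where
  "soft_subset A F G \<longleftrightarrow> (\<forall>a\<in>A. F a \<subseteq> G a)"

definition soft_Union :: "'a set \<Rightarrow> ('a \<Rightarrow> 'u set) set \<Rightarrow> 'a \<Rightarrow> 'u set" where
  "soft_Union A S = (\<lambda>a\<in>A. \<Union>F\<in>S. F a)"

text \<open>The intersection of the empty family is the whole soft set.\<close>

definition soft_Inter :: "'u set \<Rightarrow> 'a set \<Rightarrow> ('a \<Rightarrow> 'u set) set \<Rightarrow> 'a \<Rightarrow> 'u set" where
  "soft_Inter U A S = (\<lambda>a\<in>A. U \<inter> (\<Inter>F\<in>S. F a))"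

definition soft_inter :: "'a set \<Rightarrow> ('a \<Rightarrow> 'u set) \<Rightarrow> ('a \<Rightarrow> 'u set) \<Rightarrow> 'a \<Rightarrow> 'u set" where
  "soft_inter A F G = (\<lambda>a\<in>A. F a \<inter> G a)"

definition soft_compl :: "'u set \<Rightarrow> 'a set \<Rightarrow> ('a \<Rightarrow> 'u set) \<Rightarrow> 'a \<Rightarrow> 'u set" where
  "soft_compl U A F = (\<lambda>a\<in>A. U - F a)"

definition soft_topology :: "'u set \<Rightarrow> 'a set \<Rightarrow> ('a \<Rightarrow> 'u set) set \<Rightarrow> bool" where
  "soft_topology U A \<tau> \<longleftrightarrow>
     \<tau> \<subseteq> soft_sets U A \<and>
     soft_empty A \<in> \<tau> \<and>
     soft_whole U A \<in> \<tau> \<and>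
     (\<forall>S. S \<subseteq> \<tau> \<longrightarrow> soft_Union A S \<in> \<tau>) \<and>
     (\<forall>F\<in>\<tau>. \<forall>G\<in>\<tau>. soft_inter A F G \<in> \<tau>)"

definition soft_closed_sets ::
    "'u set \<Rightarrow> 'a set \<Rightarrow> ('a \<Rightarrow> 'u set) set \<Rightarrow> ('a \<Rightarrow> 'u set) set" where
  "soft_closed_sets U A \<tau> = soft_compl U A ` \<tau>"

definition soft_closure ::
    "'u set \<Rightarrow> 'a set \<Rightarrow> ('a \<Rightarrow> 'u set) set \<Rightarrow> ('a \<Rightarrow> 'u set) \<Rightarrow> 'a \<Rightarrow> 'u set" where
  "soft_closure U A \<tau> F = soft_Inter U A {C \<in> soft_closed_sets U A \<tau>. soft_subset A F C}"

definition soft_interior ::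
    "'a set \<Rightarrow> ('a \<Rightarrow> 'u set) set \<Rightarrow> ('a \<Rightarrow> 'u set) \<Rightarrow> 'a \<Rightarrow> 'u set" where
  "soft_interior A \<tau> F = soft_Union A {H \<in> \<tau>. soft_subset A H F}"

definition soft_semiopen ::
    "'u set \<Rightarrow> 'a set \<Rightarrow> ('a \<Rightarrow> 'u set) set \<Rightarrow> ('a \<Rightarrow> 'u set) \<Rightarrow> bool" where
  "soft_semiopen U A \<tau> G \<longleftrightarrow>
     G \<in> soft_sets U A \<and>
     (\<exists>H\<in>\<tau>. soft_subset A H G \<and> soft_subset A G (soft_closure U A \<tau> H))"

definition ssint ::
    "'u set \<Rightarrow> 'a set \<Rightarrow> ('a \<Rightarrow> 'u set) set \<Rightarrow> ('a \<Rightarrow> 'u set) \<Rightarrow> 'a \<Rightarrow> 'u set" where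
  "ssint U A \<tau> G = soft_Union A {H. soft_semiopen U A \<tau> H \<and> soft_subset A H G}"

text \<open>
  A soft function is given by a map \<open>u\<close> on the universe and a map \<open>p\<close> between the parameter sets.
  The values of \<open>u\<close> outside \<open>U\<close> and of \<open>p\<close> outside \<open>A\<close> play no role.
\<close>

definition soft_function ::
    "'u set \<Rightarrow> 'a set \<Rightarrow> 'b set \<Rightarrow> ('u \<Rightarrow> 'u) \<Rightarrow> ('a \<Rightarrow> 'b) \<Rightarrow> bool" where
  "soft_function U A B u p \<longleftrightarrow> u \<in> U \<rightarrow> U \<and> p \<in> A \<rightarrow> B"

definition soft_vimage ::
    "'u set \<Rightarrow> 'a set \<Rightarrow> ('u \<Rightarrow> 'u) \<Rightarrow> ('a \<Rightarrow> 'b) \<Rightarrow> ('b \<Rightarrow> 'u set) \<Rightarrow> 'a \<Rightarrow> 'u set" where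
  "soft_vimage U A u p G = (\<lambda>a\<in>A. {x \<in> U. u x \<in> G (p a)})"

definition soft_semicontinuous ::
    "'u set \<Rightarrow> 'a set \<Rightarrow> ('a \<Rightarrow> 'u set) set \<Rightarrow> ('b \<Rightarrow> 'u set) set \<Rightarrow>
     ('u \<Rightarrow> 'u) \<Rightarrow> ('a \<Rightarrow> 'b) \<Rightarrow> bool" where
  "soft_semicontinuous U A \<tau> \<delta> u p \<longleftrightarrow>
     (\<forall>G\<in>\<delta>. soft_semiopen U A \<tau> (soft_vimage U A u p G))"

end

theory Submission
  imports Defs
begin

text \<open>
  Semiopenness is closed under arbitrary soft unions: if every member \<open>G\<close> of a family satisfies
  \<open>H \<subseteq> G \<subseteq> cl H\<close> for some open \<open>H\<close>, then the interior \<open>K\<close> of the union contains each such \<open>H\<close>,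
  so the union lies in \<open>cl K\<close>. Consequently \<open>ssint G\<close> is semiopen, and it is the largest semiopen
  soft set contained in \<open>G\<close>; in particular \<open>G\<close> is semiopen as soon as it is contained in \<open>ssint G\<close>.

  If \<open>f\<close> is semicontinuous, then the inverse image of the interior of \<open>H\<close> is a semiopen soft set
  contained in the inverse image of \<open>H\<close>, hence contained in the semi-interior of the latter.
  Conversely, an open \<open>G\<close> equals its interior, so the inclusion for \<open>G\<close> puts its inverse image
  inside the semi-interior of that same inverse image, which is therefore semiopen.
\<close>

lemma soft_subset_trans:
  "soft_subset A F G \<Longrightarrow> soft_subset A G H \<Longrightarrow> soft_subset A F H"
  unfolding soft_subset_def by blast

lemma soft_subset_antisym:
  assumes "F \<in> soft_sets U A" "G \<in> soft_sets U A" "soft_subset A F G" "soft_subset A G F"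
  shows "F = G"
proof (rule PiE_ext)
  show "F \<in> A \<rightarrow>\<^sub>E Pow U" "G \<in> A \<rightarrow>\<^sub>E Pow U"
    using assms(1,2) by (simp_all add: soft_sets_def)
qed (use assms(3,4) in \<open>auto simp: soft_subset_def\<close>)

lemma soft_subset_Union: "F \<in> S \<Longrightarrow> soft_subset A F (soft_Union A S)"
  unfolding soft_subset_def soft_Union_def by auto

lemma soft_Union_subset_iff:
  "soft_subset A (soft_Union A S) G \<longleftrightarrow> (\<forall>F\<in>S. soft_subset A F G)"
  unfolding soft_subset_def soft_Union_def by auto

lemma soft_Union_in_soft_sets: "S \<subseteq> soft_sets U A \<Longrightarrow> soft_Union A S \<in> soft_sets U A"
  unfolding soft_Union_def soft_sets_def by fastforce

lemma soft_interior_open: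
  assumes "soft_topology U A \<tau>"
  shows "soft_interior A \<tau> F \<in> \<tau>"
proof -
  have "{H \<in> \<tau>. soft_subset A H F} \<subseteq> \<tau>"
    by blast
  with assms show ?thesis
    unfolding soft_interior_def soft_topology_def by blast
qed

lemma soft_interior_subset: "soft_subset A (soft_interior A \<tau> F) F"
  unfolding soft_interior_def soft_Union_subset_iff by blast

lemma soft_interior_maximal:
  "H \<in> \<tau> \<Longrightarrow> soft_subset A H F \<Longrightarrow> soft_subset A H (soft_interior A \<tau> F)"
  unfolding soft_interior_def by (rule soft_subset_Union) blast

lemma soft_interior_of_open:
  assumes "soft_topology U A \<tau>" "G \<in> \<tau>"
  shows "soft_interior A \<tau> G = G"
proof (rule soft_subset_antisym)
  show "soft_interior A \<tau> G \<in> soft_sets U A" "G \<in> soft_sets U A"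
    using assms soft_interior_open[OF assms(1)] unfolding soft_topology_def by blast+
  show "soft_subset A (soft_interior A \<tau> G) G"
    by (rule soft_interior_subset)
  show "soft_subset A G (soft_interior A \<tau> G)"
    using assms(2) by (rule soft_interior_maximal) (simp add: soft_subset_def)
qed

lemma soft_closure_mono:
  assumes "soft_subset A F G"
  shows "soft_subset A (soft_closure U A \<tau> F) (soft_closure U A \<tau> G)"
proof -
  have "{C \<in> soft_closed_sets U A \<tau>. soft_subset A G C}
      \<subseteq> {C \<in> soft_closed_sets U A \<tau>. soft_subset A F C}"
    using soft_subset_trans[OF assms] by blast
  then show ?thesis
    unfolding soft_closure_def soft_Inter_def soft_subset_def by fastforce
qed

lemma soft_semiopen_Union:
  assumes "soft_topology U A \<tau>" and S: "\<And>G. G \<in> S \<Longrightarrow> soft_semiopen U A \<tau> G"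
  shows "soft_semiopen U A \<tau> (soft_Union A S)"
proof -
  let ?K = "soft_interior A \<tau> (soft_Union A S)"
  have "soft_subset A G (soft_closure U A \<tau> ?K)" if G: "G \<in> S" for G
  proof -
    obtain H where H: "H \<in> \<tau>" "soft_subset A H G" "soft_subset A G (soft_closure U A \<tau> H)"
      using S[OF G] unfolding soft_semiopen_def by blast
    have "soft_subset A H ?K"
      using H(1) soft_subset_trans[OF H(2) soft_subset_Union[OF G]]
      by (rule soft_interior_maximal)
    then show ?thesis
      by (rule soft_subset_trans[OF H(3) soft_closure_mono])
  qed
  then have "soft_subset A (soft_Union A S) (soft_closure U A \<tau> ?K)"
    by (simp add: soft_Union_subset_iff)
  moreover have "soft_Union A S \<in> soft_sets U A"
    by (rule soft_Union_in_soft_sets) (use S in \<open>auto simp: soft_semiopen_def\<close>)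
  ultimately show ?thesis
    unfolding soft_semiopen_def
    using soft_interior_open[OF assms(1)] soft_interior_subset by blast
qed

lemma ssint_semiopen:
  "soft_topology U A \<tau> \<Longrightarrow> soft_semiopen U A \<tau> (ssint U A \<tau> G)"
  unfolding ssint_def by (rule soft_semiopen_Union) auto

lemma ssint_subset: "soft_subset A (ssint U A \<tau> G) G"
  unfolding ssint_def soft_Union_subset_iff by blast

lemma ssint_maximal:
  "soft_semiopen U A \<tau> H \<Longrightarrow> soft_subset A H G \<Longrightarrow> soft_subset A H (ssint U A \<tau> G)"
  unfolding ssint_def by (rule soft_subset_Union) blast

lemma soft_semiopen_if_subset_ssint:
  assumes "soft_topology U A \<tau>" "G \<in> soft_sets U A" "soft_subset A G (ssint U A \<tau> G)"
  shows "soft_semiopen U A \<tau> G"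
proof -
  have semiopen: "soft_semiopen U A \<tau> (ssint U A \<tau> G)"
    using assms(1) by (rule ssint_semiopen)
  then have "ssint U A \<tau> G \<in> soft_sets U A"
    unfolding soft_semiopen_def by blast
  with assms(2) have "G = ssint U A \<tau> G"
    using assms(3) ssint_subset by (rule soft_subset_antisym)
  with semiopen show ?thesis
    by simp
qed

lemma soft_vimage_in_soft_sets: "soft_vimage U A u p G \<in> soft_sets U A"
  unfolding soft_vimage_def soft_sets_def by auto

lemma soft_vimage_mono:
  assumes "p \<in> A \<rightarrow> B" "soft_subset B F G"
  shows "soft_subset A (soft_vimage U A u p F) (soft_vimage U A u p G)"
  using assms unfolding soft_vimage_def soft_subset_def by fastforce

theorem theorem3p4:
  fixes U :: "'u set" and A :: "'a set" and B :: "'b set"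
    and \<tau> :: "('a \<Rightarrow> 'u set) set" and \<delta> :: "('b \<Rightarrow> 'u set) set"
    and u :: "'u \<Rightarrow> 'u" and p :: "'a \<Rightarrow> 'b"
  assumes "soft_topology U A \<tau>"
    and "soft_topology U B \<delta>"
    and "soft_function U A B u p"
  shows "soft_semicontinuous U A \<tau> \<delta> u p \<longleftrightarrow>
    (\<forall>H \<in> soft_sets U B.
       soft_subset A (soft_vimage U A u p (soft_interior B \<delta> H))
                     (ssint U A \<tau> (soft_vimage U A u p H)))"
    (is "_ \<longleftrightarrow> ?incl")
proof
  assume cont: "soft_semicontinuous U A \<tau> \<delta> u p"
  show ?incl
  proof (intro ballI ssint_maximal)
    fix H
    show "soft_semiopen U A \<tau> (soft_vimage U A u p (soft_interior B \<delta> H))"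
      using cont soft_interior_open[OF assms(2)] unfolding soft_semicontinuous_def by blast
    have "p \<in> A \<rightarrow> B"
      using assms(3) unfolding soft_function_def by blast
    then show "soft_subset A (soft_vimage U A u p (soft_interior B \<delta> H)) (soft_vimage U A u p H)"
      using soft_interior_subset by (rule soft_vimage_mono)
  qed
next
  assume incl: ?incl
  show "soft_semicontinuous U A \<tau> \<delta> u p"
    unfolding soft_semicontinuous_def
  proof
    fix G
    assume G: "G \<in> \<delta>"
    then have "G \<in> soft_sets U B"
      using assms(2) unfolding soft_topology_def by blast
    with incl have "soft_subset A (soft_vimage U A u p G) (ssint U A \<tau> (soft_vimage U A u p G))"
      using soft_interior_of_open[OF assms(2) G] by fastforce
    with assms(1) soft_vimage_in_soft_sets
    show "soft_semiopen U A \<tau> (soft_vimage U A u p G)"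
      by (rule soft_semiopen_if_subset_ssint)
  qed
qed

end
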